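(* Let $(X,T)$ be a transitive dynamical system. (1) The set of mean equicontinuous points of $(X,T)$ is either empty or residual. If in addition $(X,T)$ is almost mean equicontinuous, then every transitive point is mean equicontinuous. (2) If $(X,T)$ is minimal and almost mean equicontinuous, then it is mean equicontinuous.
   Context: A dynamical system $(X,T)$ is a compact metric space $(X,d)$ together with a continuous map $T\colon X\to X$. $B(x,\varepsilon)$ is the open ball. $\omega(x,T)=\bigcap_{N\ge0}\overline{\{T^nx\colon n\ge N\}}$. $(X,T)$ is transitive if $\omega(x,T)=X$ for some $x\in X$; such an $x$ is called a transitive point. $(X,T)$ is minimal if every point of $X$ is a transitive point. A point $x\in X$ is mean equicontinuous if for every $\varepsilon>0$ there is $\delta>0$ such that for every $y\in B(x,\delta)$, $\limsup_{n\to\infty}\frac1n\sum_{i=0}^{n-1}d(T^ix,T^iy)<\varepsilon$. A transitive system is almost mean equicontinuous if it has at least one mean equicontinuous point. $(X,T)$ is mean equicontinuous if for every $\varepsilon>0$ there is $\delta>0$ such that for all $x,y\in X$ with $d(x,y)<\delta$, $\limsup_{n\to\infty}\frac1n\sum_{i=0}^{n-1}d(T^ix,T^iy)<\varepsilon$. A subset of $X$ is residual if it contains the intersection of a countable collection of dense open sets. *)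

theory Defs
  imports "HOL-Analysis.Analysis"
begin

text \<open>
  A compact metric space is a compact set \<open>X\<close> in a type of class \<^class>\<open>metric_space\<close>, with the
  induced metric; only the values of \<open>T\<close> on \<open>X\<close> matter.
\<close>

definition dynamical_system :: "'a::metric_space set \<Rightarrow> ('a \<Rightarrow> 'a) \<Rightarrow> bool" where
  "dynamical_system X T \<longleftrightarrow> compact X \<and> continuous_on X T \<and> T ` X \<subseteq> X"

text \<open>
  For \<open>x \<in> X\<close> the closure in the ambient type agrees with the closure in \<open>X\<close>, since a compact
  set is closed.
\<close>

definition omega_limit_set :: "('a::metric_space \<Rightarrow> 'a) \<Rightarrow> 'a \<Rightarrow> 'a set" where
  "omega_limit_set T x = (\<Inter>N. closure {(T ^^ n) x | n. n \<ge> N})"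

definition transitive_point :: "'a::metric_space set \<Rightarrow> ('a \<Rightarrow> 'a) \<Rightarrow> 'a \<Rightarrow> bool" where
  "transitive_point X T x \<longleftrightarrow> x \<in> X \<and> omega_limit_set T x = X"

definition transitive_system :: "'a::metric_space set \<Rightarrow> ('a \<Rightarrow> 'a) \<Rightarrow> bool" where
  "transitive_system X T \<longleftrightarrow> dynamical_system X T \<and> (\<exists>x\<in>X. transitive_point X T x)"

definition minimal_system :: "'a::metric_space set \<Rightarrow> ('a \<Rightarrow> 'a) \<Rightarrow> bool" where
  "minimal_system X T \<longleftrightarrow> dynamical_system X T \<and> (\<forall>x\<in>X. transitive_point X T x)"

text \<open>
  The limit superior is taken in \<^typ>\<open>ereal\<close>; the term for \<open>n = 0\<close>, where the quotient is \<open>0 / 0 = 0\<close>,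
  does not affect it.
\<close>

definition mean_orbit_dist :: "('a::metric_space \<Rightarrow> 'a) \<Rightarrow> 'a \<Rightarrow> 'a \<Rightarrow> ereal" where
  "mean_orbit_dist T x y =
     limsup (\<lambda>n. ereal ((\<Sum>i<n. dist ((T ^^ i) x) ((T ^^ i) y)) / real n))"

definition mean_equicontinuous_point :: "'a::metric_space set \<Rightarrow> ('a \<Rightarrow> 'a) \<Rightarrow> 'a \<Rightarrow> bool" where
  "mean_equicontinuous_point X T x \<longleftrightarrow>
     x \<in> X \<and> (\<forall>\<epsilon>>0. \<exists>\<delta>>0. \<forall>y \<in> X \<inter> ball x \<delta>. mean_orbit_dist T x y < ereal \<epsilon>)"

definition almost_mean_equicontinuous :: "'a::metric_space set \<Rightarrow> ('a \<Rightarrow> 'a) \<Rightarrow> bool" where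
  "almost_mean_equicontinuous X T \<longleftrightarrow>
     transitive_system X T \<and> (\<exists>x\<in>X. mean_equicontinuous_point X T x)"

definition mean_equicontinuous :: "'a::metric_space set \<Rightarrow> ('a \<Rightarrow> 'a) \<Rightarrow> bool" where
  "mean_equicontinuous X T \<longleftrightarrow>
     dynamical_system X T \<and>
     (\<forall>\<epsilon>>0. \<exists>\<delta>>0. \<forall>x\<in>X. \<forall>y\<in>X. dist x y < \<delta> \<longrightarrow> mean_orbit_dist T x y < ereal \<epsilon>)"

text \<open>
  Open and dense are relative to \<open>X\<close>. Intersecting with \<open>X\<close> only matters for the empty collection,
  whose intersection within \<open>X\<close> is \<open>X\<close>.
\<close>

definition residual_in :: "'a::topological_space set \<Rightarrow> 'a set \<Rightarrow> bool" where
  "residual_in X S \<longleftrightarrow>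
     S \<subseteq> X \<and>
     (\<exists>\<G>. countable \<G> \<and>
          (\<forall>U\<in>\<G>. openin (top_of_set X) U \<and> X \<subseteq> closure U) \<and>
          X \<inter> \<Inter>\<G> \<subseteq> S)"

end

theory Submission
  imports Defs
begin

text \<open>
  Let \<open>E\<^sub>\<epsilon>\<close> be the set of points having a neighbourhood of mean diameter below \<open>\<epsilon>\<close>. It is open
  in \<open>X\<close>, the mean equicontinuous points are the intersection of all \<open>E\<^sub>\<epsilon>\<close>, and \<open>E\<^sub>\<epsilon>\<close> is backward
  invariant under \<open>T\<close>. The orbit of a transitive point keeps returning to every nonempty open set,
  so if \<open>E\<^sub>\<epsilon>\<close> is nonempty, it contains the whole orbit and is therefore dense. Minimality makes
  every point mean equicontinuous, and a Lebesgue number of the resulting cover gives uniformity.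
\<close>

text \<open>This is \<open>E\<^sub>\<epsilon>\<close>. The condition compares any two points of the
  ball, not only the centre with another point: this form passes to smaller balls around nearby
  centres, hence openness.\<close>

definition mean_small_set :: "'a::metric_space set \<Rightarrow> ('a \<Rightarrow> 'a) \<Rightarrow> real \<Rightarrow> 'a set" where
  "mean_small_set X T \<epsilon> =
     {x \<in> X. \<exists>\<delta>>0. \<forall>y \<in> X \<inter> ball x \<delta>. \<forall>z \<in> X \<inter> ball x \<delta>. mean_orbit_dist T y z < ereal \<epsilon>}"

lemma mean_orbit_dist_commute: "mean_orbit_dist T x y = mean_orbit_dist T y x"
  unfolding mean_orbit_dist_def by (simp add: dist_commute)

lemma mean_orbit_dist_triangle:
  "mean_orbit_dist T x z \<le> mean_orbit_dist T x y + mean_orbit_dist T y z"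
proof -
  let ?a = "\<lambda>x y n. ereal ((\<Sum>i<n. dist ((T ^^ i) x) ((T ^^ i) y)) / real n)"
  have "?a x z n \<le> ?a x y n + ?a y z n" for n
    by (auto simp: add_divide_distrib[symmetric] sum.distrib[symmetric]
        intro!: divide_right_mono sum_mono dist_triangle)
  then have "limsup (?a x z) \<le> limsup (\<lambda>n. ?a x y n + ?a y z n)"
    by (intro Limsup_mono always_eventually) blast
  also have "\<dots> \<le> limsup (?a x y) + limsup (?a y z)"
    by (rule ereal_limsup_add_mono)
  finally show ?thesis
    unfolding mean_orbit_dist_def .
qed

text \<open>The shift loses only the initial distance, and \<open>dist x y / n\<close> tends to 0.
  This direction carries smallness from images back to preimages.\<close>

lemma mean_orbit_dist_le_shift: "mean_orbit_dist T x y \<le> mean_orbit_dist T (T x) (T y)"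
proof -
  let ?d = "\<lambda>i. dist ((T ^^ i) x) ((T ^^ i) y)"
  let ?b = "\<lambda>n. ereal ((\<Sum>i<n. dist ((T ^^ i) (T x)) ((T ^^ i) (T y))) / real n)"
  \<comment> \<open>The right side is the sum over \<open>i < Suc n\<close>. The surplus term keeps
    \<open>n\<close> summands in the shifted sum, matching the divisor \<open>n\<close>.\<close>
  have "(\<Sum>i<n. ?d i) \<le> ?d 0 + (\<Sum>i<n. ?d (Suc i))" for n
    by (subst sum.lessThan_Suc_shift[symmetric]) simp
  then have "ereal ((\<Sum>i<n. ?d i) / real n) \<le> ereal (dist x y / real n) + ?b n" for n
    by (simp add: funpow_swap1 add_divide_distrib[symmetric] divide_right_mono)
  then have "mean_orbit_dist T x y \<le> limsup (\<lambda>n. ereal (dist x y / real n) + ?b n)"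
    unfolding mean_orbit_dist_def by (intro Limsup_mono always_eventually) blast
  also have "\<dots> \<le> limsup (\<lambda>n. ereal (dist x y / real n)) + limsup ?b"
    by (rule ereal_limsup_add_mono)
  also have "limsup (\<lambda>n. ereal (dist x y / real n)) = 0"
    by (rule lim_imp_Limsup)
      (use lim_const_over_n[of "dist x y"] in \<open>simp_all add: zero_ereal_def\<close>)
  finally show ?thesis
    unfolding mean_orbit_dist_def by simp
qed

lemma openin_mean_small_set: "openin (top_of_set X) (mean_small_set X T \<epsilon>)"
  unfolding openin_euclidean_subtopology_iff
proof (intro conjI ballI)
  show "mean_small_set X T \<epsilon> \<subseteq> X"
    by (auto simp: mean_small_set_def)
next
  fix x assume "x \<in> mean_small_set X T \<epsilon>"
  then obtain \<delta> where \<delta>: "\<delta> > 0"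
    "\<And>y z. y \<in> X \<inter> ball x \<delta> \<Longrightarrow> z \<in> X \<inter> ball x \<delta> \<Longrightarrow> mean_orbit_dist T y z < ereal \<epsilon>"
    by (auto simp: mean_small_set_def)
  have "x' \<in> mean_small_set X T \<epsilon>" if "x' \<in> X" "dist x' x < \<delta> / 2" for x'
  proof -
    have "ball x' (\<delta> / 2) \<subseteq> ball x \<delta>"
      using that(2) dist_triangle_half_r[of x' x \<delta>] by (auto simp: dist_commute)
    then have "\<forall>y \<in> X \<inter> ball x' (\<delta> / 2). \<forall>z \<in> X \<inter> ball x' (\<delta> / 2).
        mean_orbit_dist T y z < ereal \<epsilon>"
      using \<delta>(2) by blast
    then show ?thesis
      using that \<delta>(1) unfolding mean_small_set_def by (auto intro!: exI[of _ "\<delta> / 2"])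
  qed
  then show "\<exists>e>0. \<forall>x'\<in>X. dist x' x < e \<longrightarrow> x' \<in> mean_small_set X T \<epsilon>"
    using \<delta>(1) by (intro exI[of _ "\<delta> / 2"]) auto
qed

text \<open>Two points near \<open>x\<close> are compared through \<open>x\<close>, each at a cost
  below \<open>\<epsilon> / 2\<close>.\<close>

lemma mean_equicontinuous_point_imp_mean_small:
  assumes "mean_equicontinuous_point X T x" and "\<epsilon> > 0"
  shows "x \<in> mean_small_set X T \<epsilon>"
proof -
  obtain \<delta> where x: "x \<in> X" and \<delta>: "\<delta> > 0"
    "\<And>y. y \<in> X \<inter> ball x \<delta> \<Longrightarrow> mean_orbit_dist T x y < ereal (\<epsilon> / 2)"
    using assms unfolding mean_equicontinuous_point_def by (meson half_gt_zero)
  have "mean_orbit_dist T y z < ereal \<epsilon>" if "y \<in> X \<inter> ball x \<delta>" "z \<in> X \<inter> ball x \<delta>" for y z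
  proof -
    have "mean_orbit_dist T y z \<le> mean_orbit_dist T y x + mean_orbit_dist T x z"
      by (rule mean_orbit_dist_triangle)
    also have "\<dots> < ereal (\<epsilon> / 2) + ereal (\<epsilon> / 2)"
      using \<delta>(2)[OF that(1)] \<delta>(2)[OF that(2)] mean_orbit_dist_commute[of T y x]
      by (intro ereal_add_strict_mono2) simp_all
    finally show ?thesis
      by simp
  qed
  then show ?thesis
    using x \<delta>(1) unfolding mean_small_set_def by blast
qed

text \<open>The centre \<open>x\<close> may serve as one point of the pair. Restricting to the
  values \<open>1 / Suc n\<close> leaves a countable family, as residuality demands.\<close>

lemma mean_small_imp_mean_equicontinuous_point:
  assumes "x \<in> X" and "\<And>n. x \<in> mean_small_set X T (1 / real (Suc n))"
  shows "mean_equicontinuous_point X T x"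
  unfolding mean_equicontinuous_point_def
proof (intro conjI allI impI)
  fix \<epsilon> :: real assume "\<epsilon> > 0"
  then obtain n where n: "1 / real (Suc n) < \<epsilon>"
    using nat_approx_posE by blast
  obtain \<delta> where \<delta>: "\<delta> > 0" "\<And>y z. y \<in> X \<inter> ball x \<delta> \<Longrightarrow> z \<in> X \<inter> ball x \<delta> \<Longrightarrow>
      mean_orbit_dist T y z < ereal (1 / real (Suc n))"
    using assms(2)[of n] by (auto simp: mean_small_set_def)
  have "mean_orbit_dist T x y < ereal \<epsilon>" if "y \<in> X \<inter> ball x \<delta>" for y
    using \<delta>(2)[of x y] \<delta>(1) that assms(1) n by (auto intro: less_trans)
  then show "\<exists>\<delta>>0. \<forall>y\<in>X \<inter> ball x \<delta>. mean_orbit_dist T x y < ereal \<epsilon>"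
    using \<delta>(1) by blast
qed (rule assms(1))

text \<open>By continuity, \<open>T\<close> maps a small ball around \<open>x\<close> into the ball
  given for \<open>T x\<close>, and a pair has mean distance at most that of its images.\<close>

lemma mean_small_set_preimage:
  assumes "dynamical_system X T" and "x \<in> X" and "T x \<in> mean_small_set X T \<epsilon>"
  shows "x \<in> mean_small_set X T \<epsilon>"
proof -
  obtain \<delta> where \<delta>: "\<delta> > 0" "\<And>y z. y \<in> X \<inter> ball (T x) \<delta> \<Longrightarrow> z \<in> X \<inter> ball (T x) \<delta> \<Longrightarrow>
      mean_orbit_dist T y z < ereal \<epsilon>"
    using assms(3) by (auto simp: mean_small_set_def)
  have TX: "T ` X \<subseteq> X" and "continuous_on X T"
    using assms(1) by (auto simp: dynamical_system_def)
  then obtain \<eta> where \<eta>: "\<eta> > 0" "\<And>y. y \<in> X \<Longrightarrow> dist y x < \<eta> \<Longrightarrow> dist (T y) (T x) < \<delta>"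
    using assms(2) \<delta>(1) unfolding continuous_on_iff by meson
  have T: "T y \<in> X \<inter> ball (T x) \<delta>" if "y \<in> X \<inter> ball x \<eta>" for y
    using \<eta>(2)[of y] that TX by (auto simp: dist_commute)
  have "mean_orbit_dist T y z < ereal \<epsilon>" if "y \<in> X \<inter> ball x \<eta>" "z \<in> X \<inter> ball x \<eta>" for y z
    using mean_orbit_dist_le_shift \<delta>(2)[OF T T, OF that] by (rule le_less_trans)
  then show ?thesis
    using assms(2) \<eta>(1) unfolding mean_small_set_def by blast
qed

lemma funpow_in_invariant_set:
  assumes "T ` X \<subseteq> X" and "x \<in> X"
  shows "(T ^^ n) x \<in> X"
  using assms by (induction n) auto

lemma mean_small_set_funpow_preimage:
  assumes "dynamical_system X T" and "x \<in> X" and "(T ^^ n) x \<in> mean_small_set X T \<epsilon>"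
  shows "x \<in> mean_small_set X T \<epsilon>"
  using assms(3)
proof (induction n)
  case (Suc n)
  have "(T ^^ n) x \<in> X"
    using assms(1,2) by (intro funpow_in_invariant_set) (auto simp: dynamical_system_def)
  then show ?case
    using Suc mean_small_set_preimage[OF assms(1)] by auto
qed simp

text \<open>A point of the omega-limit set lies in the closure of every tail of the orbit, so visits
  occur beyond any prescribed time \<open>N\<close>.\<close>

lemma transitive_point_visits:
  assumes "transitive_point X T x" and "z \<in> X" and "open U" and "z \<in> U"
  obtains n where "n \<ge> N" and "(T ^^ n) x \<in> U"
proof -
  have "z \<in> closure {(T ^^ n) x | n. n \<ge> N}"
    using assms(1,2) by (auto simp: transitive_point_def omega_limit_set_def)
  then show thesis
    using assms(3,4) that open_Int_closure_eq_empty[OF assms(3)] by blast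
qed

lemma transitive_orbit_mean_small:
  assumes "dynamical_system X T" and "transitive_point X T x" and "mean_small_set X T \<epsilon> \<noteq> {}"
  shows "(T ^^ n) x \<in> mean_small_set X T \<epsilon>"
proof -
  have x: "(T ^^ n) x \<in> X" for n
    using assms(1,2)
    by (intro funpow_in_invariant_set) (auto simp: dynamical_system_def transitive_point_def)
  \<comment> \<open>Visits are available for ambient open sets, so the relatively open set is
    written as a trace on \<open>X\<close>.\<close>
  obtain U where U: "open U" "mean_small_set X T \<epsilon> = X \<inter> U"
    using openin_mean_small_set[of X T \<epsilon>] by (auto simp: openin_open)
  obtain z where "z \<in> X" "z \<in> U"
    using assms(3) U(2) by blast
  then obtain k where k: "k \<ge> n" "(T ^^ k) x \<in> U"
    using transitive_point_visits[OF assms(2) _ U(1)] by blast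
  \<comment> \<open>The visit at time \<open>k\<close> is a future iterate of the point at time
    \<open>n\<close>; \<open>k \<ge> n\<close> makes the natural subtraction exact. Backward
    invariance then applies.\<close>
  have "(T ^^ (k - n)) ((T ^^ n) x) = (T ^^ k) x"
    using k(1) by (simp flip: funpow_add[THEN fun_cong, unfolded o_apply])
  then have "(T ^^ (k - n)) ((T ^^ n) x) \<in> mean_small_set X T \<epsilon>"
    using k(2) x[of k] U(2) by simp
  then show ?thesis
    by (rule mean_small_set_funpow_preimage[OF assms(1) x])
qed

lemma mean_small_set_dense:
  assumes "transitive_system X T" and "mean_small_set X T \<epsilon> \<noteq> {}"
  shows "X \<subseteq> closure (mean_small_set X T \<epsilon>)"
proof
  fix y assume y: "y \<in> X"
  obtain x where x: "dynamical_system X T" "transitive_point X T x"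
    using assms(1) by (auto simp: transitive_system_def)
  show "y \<in> closure (mean_small_set X T \<epsilon>)"
    unfolding closure_iff_nhds_not_empty
  proof (intro allI impI)
    fix A U assume "U \<subseteq> A" "open U" "y \<in> U"
    moreover obtain n where "(T ^^ n) x \<in> U"
      using transitive_point_visits[OF x(2) y \<open>open U\<close> \<open>y \<in> U\<close>] by blast
    ultimately show "mean_small_set X T \<epsilon> \<inter> A \<noteq> {}"
      using transitive_orbit_mean_small[OF x assms(2), of n] by blast
  qed
qed

lemma residual_mean_equicontinuous_points:
  assumes "transitive_system X T" and "mean_equicontinuous_point X T x"
  shows "residual_in X {x \<in> X. mean_equicontinuous_point X T x}"
  unfolding residual_in_def
proof (intro conjI exI)
  let ?\<G> = "range (\<lambda>n. mean_small_set X T (1 / real (Suc n)))"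
  show "countable ?\<G>"
    by simp
  \<comment> \<open>The single given mean equicontinuous point lies in all these sets; being
    nonempty, they are dense by transitivity.\<close>
  have "mean_small_set X T (1 / real (Suc n)) \<noteq> {}" for n
    using mean_equicontinuous_point_imp_mean_small[OF assms(2), of "1 / real (Suc n)"] by auto
  then show "\<forall>U\<in>?\<G>. openin (top_of_set X) U \<and> X \<subseteq> closure U"
    using openin_mean_small_set mean_small_set_dense[OF assms(1)] by blast
  show "X \<inter> \<Inter>?\<G> \<subseteq> {x \<in> X. mean_equicontinuous_point X T x}"
    using mean_small_imp_mean_equicontinuous_point by fast
qed auto

lemma transitive_point_mean_equicontinuous:
  assumes "almost_mean_equicontinuous X T" and "transitive_point X T x"
  shows "mean_equicontinuous_point X T x"
proof (rule mean_small_imp_mean_equicontinuous_point)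
  show "x \<in> X"
    using assms(2) by (simp add: transitive_point_def)
  obtain y where X: "dynamical_system X T" and y: "mean_equicontinuous_point X T y"
    using assms(1) by (auto simp: almost_mean_equicontinuous_def transitive_system_def)
  fix n
  have "mean_small_set X T (1 / real (Suc n)) \<noteq> {}"
    using mean_equicontinuous_point_imp_mean_small[OF y, of "1 / real (Suc n)"] by auto
  \<comment> \<open>At time 0 the orbit point is \<open>x\<close> itself.\<close>
  from transitive_orbit_mean_small[OF X assms(2) this, of 0]
  show "x \<in> mean_small_set X T (1 / real (Suc n))"
    by simp
qed

lemma mean_equicontinuous_if_pointwise:
  assumes "dynamical_system X T" and "\<And>x. x \<in> X \<Longrightarrow> mean_equicontinuous_point X T x"
  shows "mean_equicontinuous X T"
  unfolding mean_equicontinuous_def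
proof (intro conjI allI impI)
  fix \<epsilon> :: real assume \<epsilon>: "\<epsilon> > 0"
  let ?\<G> = "{ball x \<delta> | x \<delta>. \<forall>y \<in> X \<inter> ball x \<delta>. \<forall>z \<in> X \<inter> ball x \<delta>. mean_orbit_dist T y z < ereal \<epsilon>}"
  have "compact X"
    using assms(1) by (simp add: dynamical_system_def)
  moreover have "X \<subseteq> \<Union>?\<G>"
  proof
    fix x assume "x \<in> X"
    then have "x \<in> mean_small_set X T \<epsilon>"
      using mean_equicontinuous_point_imp_mean_small assms(2) \<epsilon> by blast
    then obtain \<delta> where "\<delta> > 0" "ball x \<delta> \<in> ?\<G>"
      unfolding mean_small_set_def by blast
    then show "x \<in> \<Union>?\<G>"
      by (meson UnionI centre_in_ball)
  qed
  moreover have "open G" if "G \<in> ?\<G>" for G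
    using that by auto
  \<comment> \<open>\<open>e\<close> is a Lebesgue number of the cover: points of \<open>X\<close>
    closer than \<open>e\<close> share a member, whatever their position.\<close>
  ultimately obtain e where e: "e > 0" "\<And>x. x \<in> X \<Longrightarrow> \<exists>G\<in>?\<G>. ball x e \<subseteq> G"
    by (rule Heine_Borel_lemma) (assumption | rule that)+
  have "mean_orbit_dist T x y < ereal \<epsilon>" if "x \<in> X" "y \<in> X" "dist x y < e" for x y
  proof -
    have "x \<in> ball x e" "y \<in> ball x e"
      using that e(1) by auto
    then show ?thesis
      using e(2)[OF that(1)] that(1,2) by blast
  qed
  then show "\<exists>\<delta>>0. \<forall>x\<in>X. \<forall>y\<in>X. dist x y < \<delta> \<longrightarrow> mean_orbit_dist T x y < ereal \<epsilon>"
    using e(1) by blast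
qed (rule assms(1))

theorem proposition4p3:
  fixes X :: "'a::metric_space set" and T :: "'a \<Rightarrow> 'a"
  assumes "transitive_system X T"
  shows "({x \<in> X. mean_equicontinuous_point X T x} = {} \<or>
            residual_in X {x \<in> X. mean_equicontinuous_point X T x}) \<and>
         (almost_mean_equicontinuous X T \<longrightarrow>
            (\<forall>x\<in>X. transitive_point X T x \<longrightarrow> mean_equicontinuous_point X T x)) \<and>
         (minimal_system X T \<and> almost_mean_equicontinuous X T \<longrightarrow> mean_equicontinuous X T)"
  \<comment> \<open>Any element of a nonempty set of mean equicontinuous points yields residuality.
    Under minimality all points are transitive, hence mean equicontinuous, and compactness makes
    this uniform.\<close>
  using residual_mean_equicontinuous_points[OF assms] transitive_point_mean_equicontinuous
    mean_equicontinuous_if_pointwise[of X T]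
  unfolding minimal_system_def by blast

end
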